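(* Let $n\ge1$ and let $(f^B_{ij})_{0\le j\le i\le n}$ be the $f$-triangle of $\Delta_{\mathrm{SDyck}_{2n}}$. Then for $0\le j\le i\le n$ \[ f^B_{ij}=\Big|\left\{\,w\in\mathrm{SDyck}_{2n} : |V^{\mathrm{half}}(w)|=j\text{ and }\mu_B(w)=i\,\right\}\Big| . \]
   Context: A Dyck path of semilength $m$ is a word $w=w_1\cdots w_{2m}$ in $\{U,D\}$ with equally many $U$'s and $D$'s such that every prefix contains at least as many $U$'s as $D$'s. It is symmetric if $w_{2m+1-i}=\overline{w_i}$ for all $1\le i\le 2m$, where $\overline U=D$, $\overline D=U$. $\mathrm{SDyck}_{2n}$ is the set of symmetric Dyck paths of semilength $2n$ (length $4n$). A valley of $w$ is an index $i$ with $w_i=D$, $w_{i+1}=U$, identified with its position $(i,y)$, where $y$ is the number of $U$'s minus the number of $D$'s in $w_1\cdots w_i$; $V(w)$ is the set of valley positions. For $w\in\mathrm{SDyck}_{2n}$ put $V^{\mathrm{half}}(w)=\{(x,y)\in V(w): x\le 2n\}$, and $\Delta_{\mathrm{SDyck}_{2n}}=\{V^{\mathrm{half}}(w) : w\in\mathrm{SDyck}_{2n}\}$, which is a simplicial complex (isomorphic to the complex of antichains in the root poset of type $B_n$). Write $V^{\mathrm{half}}(w)=\{(x_1,y_1),\ldots,(x_\ell,y_\ell)\}$ with $x_1<\cdots<x_\ell$, and set $d_k=\frac{x_k-y_k}{2}$, $u_k=\frac{x_k+y_k}{2}$. If $\ell\ge1$ define \[ \mu_B(w)=d_1+\sum_{k=1}^{\ell-1}\min\{d_{k+1}-d_k,\;u_{k+1}-u_k\}+\left\lfloor\frac{2n-d_\ell-u_\ell}{2}\right\rfloor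 , \] and if $V^{\mathrm{half}}(w)=\varnothing$ set $\mu_B(w)=n$. For a simplicial complex $\Delta$, the degree of a face $\sigma$ is $\deg(\sigma)=\max\{|\tau| : \tau\in\Delta,\ \sigma\subseteq\tau\}$. The $f$-triangle of $\Delta$ is the array $(f_{ij})$ where $f_{ij}$ is the number of faces $\sigma$ with $|\sigma|=j$ and $\deg(\sigma)=i$. *)

theory Defs
  imports Main
begin

datatype step = U | D

primrec flip :: "step \<Rightarrow> step" where
  "flip U = D"
| "flip D = U"

text \<open>Letters of words are numbered from 1: the letter \<open>w\<^sub>i\<close> is \<open>letter w i\<close>,
  meaningful for \<open>1 \<le> i \<le> length w\<close>.\<close>

definition letter :: "step list \<Rightarrow> nat \<Rightarrow> step" where
  "letter w i = w ! (i - 1)"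

definition dyck_path :: "nat \<Rightarrow> step list \<Rightarrow> bool" where
  "dyck_path m w \<longleftrightarrow>
     length w = 2 * m \<and>
     count_list w U = count_list w D \<and>
     (\<forall>k\<le>2 * m. count_list (take k w) D \<le> count_list (take k w) U)"

definition SDyck :: "nat \<Rightarrow> step list set" where
  "SDyck m = {w. dyck_path m w \<and>
     (\<forall>i\<in>{1..2 * m}. letter w (2 * m + 1 - i) = flip (letter w i))}"

definition height :: "step list \<Rightarrow> nat \<Rightarrow> int" where
  "height w i = int (count_list (take i w) U) - int (count_list (take i w) D)"

definition valleys :: "step list \<Rightarrow> (int \<times> int) set" where
  "valleys w = {(int i, height w i) | i.
     1 \<le> i \<and> i + 1 \<le> length w \<and> letter w i = D \<and> letter w (i + 1) = U}"

text \<open>The half valley set of a path of semilength \<open>2 * n\<close>; the midpoint \<open>x = 2 * n\<close> is included.\<close>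

definition half_valleys :: "nat \<Rightarrow> step list \<Rightarrow> (int \<times> int) set" where
  "half_valleys n w = {(x, y) \<in> valleys w. x \<le> 2 * int n}"

definition SDyck_complex :: "nat \<Rightarrow> (int \<times> int) set set" where
  "SDyck_complex n = half_valleys n ` SDyck (2 * n)"

text \<open>Distinct valleys have distinct abscissae, so sorting by the first component lists
  the set as \<open>(x\<^sub>1, y\<^sub>1), \<dots>, (x\<^sub>\<ell>, y\<^sub>\<ell>)\<close> with \<open>x\<^sub>1 < \<dots> < x\<^sub>\<ell>\<close>.\<close>

definition half_valley_list :: "nat \<Rightarrow> step list \<Rightarrow> (int \<times> int) list" where
  "half_valley_list n w = sorted_key_list_of_set fst (half_valleys n w)"

text \<open>For a valley \<open>(x, y)\<close> the numbers \<open>x\<close> and \<open>y\<close> have the same parity, so both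
  divisions by 2 are exact: they count the down steps and the up steps before the valley.\<close>

definition down_coord :: "int \<times> int \<Rightarrow> int" where
  "down_coord p = (fst p - snd p) div 2"

definition up_coord :: "int \<times> int \<Rightarrow> int" where
  "up_coord p = (fst p + snd p) div 2"

text \<open>The list index \<open>k\<close> is 0-based, so \<open>d k\<close> and \<open>u k\<close> below stand for
  \<open>d\<^sub>k\<^sub>+\<^sub>1\<close> and \<open>u\<^sub>k\<^sub>+\<^sub>1\<close>. The final \<open>div\<close> is the floor.\<close>

definition mu_B :: "nat \<Rightarrow> step list \<Rightarrow> int" where
  "mu_B n w =
     (let vs = half_valley_list n w;
          l = length vs;
          d = (\<lambda>k. down_coord (vs ! k));
          u = (\<lambda>k. up_coord (vs ! k))
      in if half_valleys n w = {} then int n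
         else d 0
            + (\<Sum>k<l - 1. min (d (k + 1) - d k) (u (k + 1) - u k))
            + (2 * int n - d (l - 1) - u (l - 1)) div 2)"

text \<open>The next two notions are meant for finite simplicial complexes, given as the set of
  all faces (including the empty face); faces are measured by cardinality, not dimension.\<close>

definition face_degree :: "'a set set \<Rightarrow> 'a set \<Rightarrow> nat" where
  "face_degree \<Delta> \<sigma> = Max {card \<tau> | \<tau>. \<tau> \<in> \<Delta> \<and> \<sigma> \<subseteq> \<tau>}"

definition f_triangle :: "'a set set \<Rightarrow> nat \<Rightarrow> nat \<Rightarrow> nat" where
  "f_triangle \<Delta> i j = card {\<sigma> \<in> \<Delta>. card \<sigma> = j \<and> face_degree \<Delta> \<sigma> = i}"

end

theory Submission
  imports Defs
begin

text \<open>A symmetric path is determined by its first half, and the half by its valleys. In the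
  coordinates (downs, ups) the half valley sets are exactly the chains, strictly increasing in both
  coordinates, of points \<open>(d, u)\<close> with \<open>1 \<le> d \<le> u\<close> and \<open>d + u \<le> 2n\<close>. A largest chain containing a
  given one is obtained greedily, by inserting diagonal steps \<open>(1, 1)\<close> from the origin, between
  consecutive points and after the last point; its length is \<open>\<mu>\<^sub>B\<close>. So the map sending a path
  to its half valley set is a bijection onto the faces that carries \<open>\<mu>\<^sub>B\<close> to the degree.\<close>

section \<open>Chains\<close>

text \<open>The bound \<open>m\<close> is tested only at the last point because coordinate sums grow
  along a chain. The condition \<open>d' \<le> u'\<close> keeps each valley on or above the
  axis.\<close>

fun chain :: "nat \<Rightarrow> nat \<Rightarrow> nat \<Rightarrow> (nat \<times> nat) list \<Rightarrow> bool" where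
  "chain m d u [] \<longleftrightarrow> d + u \<le> m"
| "chain m d u ((d', u') # ps) \<longleftrightarrow> d < d' \<and> u < u' \<and> d' \<le> u' \<and> chain m d' u' ps"

text \<open>This is \<open>mu_B\<close> with the start as an extra first point. From the origin,
  \<open>min d' u'\<close> is \<open>d'\<close>, and the empty chain yields \<open>m div 2\<close>,
  so both cases of \<open>mu_B\<close> are covered.\<close>

fun chain_degree :: "nat \<Rightarrow> nat \<Rightarrow> nat \<Rightarrow> (nat \<times> nat) list \<Rightarrow> nat" where
  "chain_degree m d u [] = (m - d - u) div 2"
| "chain_degree m d u ((d', u') # ps) = min (d' - d) (u' - u) + chain_degree m d' u' ps"

fun diagonal :: "nat \<Rightarrow> nat \<Rightarrow> nat \<Rightarrow> (nat \<times> nat) list" where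
  "diagonal 0 d u = []"
| "diagonal (Suc k) d u = (d + 1, u + 1) # diagonal k (d + 1) (u + 1)"

text \<open>Each inserted run stops one step short, since \<open>(d', u')\<close> itself supplies
  the last of the \<open>min (d' - d) (u' - u)\<close> points that fit in the gap.\<close>

fun saturate :: "nat \<Rightarrow> nat \<Rightarrow> nat \<Rightarrow> (nat \<times> nat) list \<Rightarrow> (nat \<times> nat) list" where
  "saturate m d u [] = diagonal ((m - d - u) div 2) d u"
| "saturate m d u ((d', u') # ps) =
     diagonal (min (d' - d) (u' - u) - 1) d u @ (d', u') # saturate m d' u' ps"

lemma length_diagonal [simp]: "length (diagonal k d u) = k"
  by (induction k d u rule: diagonal.induct) auto

text \<open>Diagonal steps leave \<open>u - d\<close> unchanged, so a start with
  \<open>d \<le> u\<close> keeps all inserted points admissible.\<close>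

lemma chain_diagonal_append:
  "d \<le> u \<Longrightarrow> chain m d u (diagonal k d u @ ps) \<longleftrightarrow> chain m (d + k) (u + k) ps"
  by (induction k d u rule: diagonal.induct) auto

lemma chain_sum_le: "chain m d u ps \<Longrightarrow> d + u + 2 * length ps \<le> m"
  by (induction m d u ps rule: chain.induct) auto

lemma chain_saturate: "chain m d u ps \<Longrightarrow> d \<le> u \<Longrightarrow> chain m d u (saturate m d u ps)"
proof (induction m d u ps rule: chain.induct)
  case (1 m d u)
  then show ?case
    using chain_diagonal_append[of d u m "(m - d - u) div 2" "[]"] by auto
next
  case (2 m d u d' u' ps)
  then show ?case by (auto simp: chain_diagonal_append)
qed

lemma length_saturate: "chain m d u ps \<Longrightarrow> length (saturate m d u ps) = chain_degree m d u ps"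
  by (induction m d u ps rule: chain.induct) auto

lemma set_subset_saturate: "set ps \<subseteq> set (saturate m d u ps)"
  by (induction m d u ps rule: saturate.induct) auto

text \<open>Every link raises both coordinates by at least one, which limits how many points fit
  before \<open>(d', u')\<close>. The last conjunct serves to locate later points in
  \<open>bs\<close>.\<close>

lemma chain_append_Cons:
  "chain m d u (as @ (d', u') # bs) \<Longrightarrow>
     d + length as < d' \<and> u + length as < u' \<and> chain m d' u' bs \<and> (\<forall>a\<in>set as. fst a < d')"
proof (induction as arbitrary: d u)
  case Nil
  then show ?case by simp
next
  case (Cons a as)
  obtain x y where a: "a = (x, y)" by (cases a)
  show ?case using Cons.IH[of x y] Cons.prems by (auto simp: a)
qed

lemma chain_gt: "chain m d u ps \<Longrightarrow> p \<in> set ps \<Longrightarrow> d < fst p \<and> u < snd p"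
  by (induction m d u ps rule: chain.induct) fastforce+

lemma chain_sorted:
  "chain m d u ps \<Longrightarrow> sorted_wrt (\<lambda>p q. fst p < fst q \<and> snd p < snd q) ps"
  by (induction m d u ps rule: chain.induct) (auto dest: chain_gt)

text \<open>Optimality of the greedy filling: the points of \<open>ps\<close> cut \<open>qs\<close>
  into pieces, each bounded by the smaller of its two gaps; after the last point each link uses up
  at least 2 of the remaining sum.\<close>

lemma length_le_chain_degree:
  "chain m d u ps \<Longrightarrow> chain m d u qs \<Longrightarrow> set ps \<subseteq> set qs \<Longrightarrow> length qs \<le> chain_degree m d u ps"
proof (induction m d u ps arbitrary: qs rule: chain.induct)
  case (1 m d u)
  then show ?case using chain_sum_le[of m d u qs] by auto
next
  case (2 m d u d' u' ps)
  then obtain as bs where qs: "qs = as @ (d', u') # bs"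
    by (metis list.set_intros(1) split_list subsetD)
  have ch: "chain m d' u' ps" using "2.prems"(1) by simp
  note split = chain_append_Cons[OF "2.prems"(2)[unfolded qs]]
  have "set ps \<subseteq> set bs"
  proof
    fix p assume p: "p \<in> set ps"
    then have "d' < fst p" using chain_gt[OF ch] by simp
    moreover have "p \<in> set qs" using p "2.prems"(3) by auto
    ultimately show "p \<in> set bs" using split by (auto simp: qs)
  qed
  then have "length bs \<le> chain_degree m d' u' ps"
    using "2.IH" ch split by blast
  then show ?case using split by (auto simp: qs)
qed

lemma chain_degree_sum:
  assumes "chain m d u ps" "ps \<noteq> []"
  shows "int (chain_degree m d u ps) =
    min (int (fst (ps ! 0)) - int d) (int (snd (ps ! 0)) - int u)
    + (\<Sum>k<length ps - 1. min (int (fst (ps ! (k + 1))) - int (fst (ps ! k)))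
                              (int (snd (ps ! (k + 1))) - int (snd (ps ! k))))
    + (int m - int (fst (ps ! (length ps - 1))) - int (snd (ps ! (length ps - 1)))) div 2"
  using assms
proof (induction m d u ps rule: chain.induct)
  case (1 m d u)
  then show ?case by simp
next
  case (2 m d u d' u' ps)
  show ?case
  proof (cases ps)
    case Nil
    with 2 show ?thesis by (auto simp: of_nat_diff zdiv_int min_def)
  next
    case (Cons q qs)
    have "int (chain_degree m d u ((d', u') # ps)) =
      min (int d' - int d) (int u' - int u) + int (chain_degree m d' u' ps)"
      using "2.prems" by (auto simp: min_def)
    also have "int (chain_degree m d' u' ps) =
      min (int (fst (ps ! 0)) - int d') (int (snd (ps ! 0)) - int u')
    + (\<Sum>k<length ps - 1. min (int (fst (ps ! (k + 1))) - int (fst (ps ! k)))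
                              (int (snd (ps ! (k + 1))) - int (snd (ps ! k))))
    + (int m - int (fst (ps ! (length ps - 1))) - int (snd (ps ! (length ps - 1)))) div 2"
      using 2 Cons by simp
    finally show ?thesis
      \<comment> \<open>The recursion peels from the front: the leading \<open>min\<close> for
        \<open>ps\<close> is the gap from \<open>(d', u')\<close> to \<open>q\<close>, that is, the
        summand \<open>k = 0\<close> of the longer chain.\<close>
      by (simp add: Cons sum.lessThan_Suc_shift del: sum.lessThan_Suc)
  qed
qed

section \<open>Valleys of a half path\<close>

text \<open>The valleys of a path from \<open>(d, u)\<close>; a final down step counts as a valley, since the step
  after the midpoint of a symmetric path is then an up step.\<close>

fun half_valley_coords :: "nat \<Rightarrow> nat \<Rightarrow> step list \<Rightarrow> (nat \<times> nat) list" where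
  "half_valley_coords d u [] = []"
| "half_valley_coords d u (U # p) = half_valley_coords d (u + 1) p"
| "half_valley_coords d u [D] = [(d + 1, u)]"
| "half_valley_coords d u (D # U # p) = (d + 1, u) # half_valley_coords (d + 1) u (U # p)"
| "half_valley_coords d u (D # D # p) = half_valley_coords (d + 1) u (D # p)"

text \<open>Ups come before downs, so that each descent bottoms out exactly at the prescribed point.
  The closing ups fill the length without creating a valley.\<close>

fun chain_path :: "nat \<Rightarrow> nat \<Rightarrow> nat \<Rightarrow> (nat \<times> nat) list \<Rightarrow> step list" where
  "chain_path m d u [] = replicate (m - d - u) U"
| "chain_path m d u ((d', u') # ps) =
     replicate (u' - u) U @ replicate (d' - d) D @ chain_path m d' u' ps"

lemma half_valley_coords_replicate_U:
  "half_valley_coords d u (replicate k U @ p) = half_valley_coords d (u + k) p"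
  by (induction k arbitrary: u) auto

lemma half_valley_coords_replicate_D:
  "p = [] \<or> hd p = U \<Longrightarrow>
   half_valley_coords d u (replicate (Suc k) D @ p) = (d + Suc k, u) # half_valley_coords (d + Suc k) u p"
proof (induction k arbitrary: d)
  case 0
  then show ?case by (cases p) auto
next
  case (Suc k)
  from Suc.IH[OF Suc.prems, of "d + 1"] show ?case by simp
qed

text \<open>Strict growth of the up coordinate makes the first run of ups nonempty. Hence the
  descent preceding this path is maximal, as \<open>half_valley_coords_replicate_D\<close>
  requires.\<close>

lemma chain_path_hd:
  assumes "chain m d u ps"
  shows "chain_path m d u ps = [] \<or> hd (chain_path m d u ps) = U"
proof (cases ps)
  case Nil
  then show ?thesis by (cases "m - d - u") auto
next
  case (Cons p ps')
  obtain d' u' where "p = (d', u')" by (cases p)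
  moreover from this assms Cons obtain k where "u' - u = Suc k"
    by (cases "u' - u") auto
  ultimately show ?thesis using Cons by simp
qed

lemma half_valley_coords_chain_path:
  "chain m d u ps \<Longrightarrow> half_valley_coords d u (chain_path m d u ps) = ps"
proof (induction m d u ps rule: chain.induct)
  case (1 m d u)
  then show ?case using half_valley_coords_replicate_U[of d u "m - d - u" "[]"] by simp
next
  case (2 m d u d' u' ps)
  then obtain k where k: "d' - d = Suc k"
    by (cases "d' - d") auto
  have "half_valley_coords d u (chain_path m d u ((d', u') # ps)) =
      half_valley_coords d u' (replicate (Suc k) D @ chain_path m d' u' ps)"
    using 2 by (simp add: half_valley_coords_replicate_U k del: replicate_Suc)
  also have "\<dots> = (d + Suc k, u') # half_valley_coords (d + Suc k) u' (chain_path m d' u' ps)"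
    using 2 by (intro half_valley_coords_replicate_D chain_path_hd) auto
  also have "d + Suc k = d'" using k by simp
  finally show ?case using 2 by simp
qed

lemma length_chain_path: "chain m d u ps \<Longrightarrow> d + u + length (chain_path m d u ps) = m"
proof (induction m d u ps rule: chain.induct)
  case (2 m d u d' u' ps)
  then have "d' + u' + length (chain_path m d' u' ps) = m" by simp
  with 2 show ?case by simp
qed simp

section \<open>Recovering a half path from its valley list\<close>

lemma half_valley_coords_ge:
  "v \<in> set (half_valley_coords d u p) \<Longrightarrow> d < fst v \<and> u \<le> snd v"
  by (induction d u p rule: half_valley_coords.induct) fastforce+

text \<open>The first valley after a down step ends the current descent, where the number of ups is
  still \<open>u\<close>; \<open>k\<close> counts the further down steps.\<close>

lemma half_valley_coords_D:
  "\<exists>k vs. half_valley_coords d u (D # p) = (d + Suc k, u) # vs \<and> (k = 0 \<longleftrightarrow> p = [] \<or> hd p = U)"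
proof (induction p arbitrary: d)
  case Nil
  then show ?case by auto
next
  case (Cons s p)
  show ?case
  proof (cases s)
    case U
    then show ?thesis by auto
  next
    case D
    obtain k vs where "half_valley_coords (d + 1) u (D # p) = (d + 1 + Suc k, u) # vs"
      using Cons.IH by blast
    then have "half_valley_coords d u (D # D # p) = (d + Suc (Suc k), u) # vs"
      by simp
    then show ?thesis using D by fastforce
  qed
qed

text \<open>After an up step every valley has more than \<open>u\<close> ups, whereas a down step
  forces a valley with exactly \<open>u\<close>.\<close>

lemma half_valley_coords_U_neq_D:
  "half_valley_coords d u (U # p) \<noteq> half_valley_coords d u (D # q)"
proof
  assume eq: "half_valley_coords d u (U # p) = half_valley_coords d u (D # q)"
  obtain k vs where "half_valley_coords d u (D # q) = (d + Suc k, u) # vs"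
    using half_valley_coords_D by blast
  then have "(d + Suc k, u) \<in> set (half_valley_coords d (u + 1) p)"
    using eq by simp
  from half_valley_coords_ge[OF this] show False by simp
qed

text \<open>The list reveals the letters one at a time. Equal lengths are assumed because trailing
  ups leave no trace in it.\<close>

lemma half_valley_coords_inj:
  "length p = length q \<Longrightarrow> half_valley_coords d u p = half_valley_coords d u q \<Longrightarrow> p = q"
proof (induction p arbitrary: d u q)
  case Nil
  then show ?case by simp
next
  case (Cons s p)
  then obtain t q' where q: "q = t # q'" and len: "length p = length q'"
    by (cases q) auto
  have st: "s = t"
    using Cons.prems(2) half_valley_coords_U_neq_D[of d u]
    by (cases s; cases t) (auto simp: q simp del: half_valley_coords.simps dest: sym)
  have "p = q'"
  proof (cases s)
    case U
    then show ?thesis using Cons.IH[OF len] Cons.prems(2) st q by auto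
  next
    case D
    then have eq: "half_valley_coords d u (D # p) = half_valley_coords d u (D # q')"
      using Cons.prems(2) st q by simp
    \<comment> \<open>The first valley tells whether the descent stops right here, so both lists
      lose their head or neither does.\<close>
    then have hd: "p = [] \<or> hd p = U \<longleftrightarrow> q' = [] \<or> hd q' = U"
      using half_valley_coords_D[of d u p] half_valley_coords_D[of d u q'] by auto
    have "half_valley_coords (d + 1) u p = half_valley_coords (d + 1) u q'"
    proof (cases p)
      case Nil
      then show ?thesis using len by simp
    next
      case (Cons a as)
      then obtain b bs where q': "q' = b # bs" using len by (cases q') auto
      show ?thesis using hd eq by (cases a; cases b) (auto simp: q' Cons)
    qed
    then show ?thesis using Cons.IH[OF len] by blast
  qed
  then show ?case using st q by simp
qed

text \<open>Inside a descent the next valley has the current \<open>u\<close>, so only weak monotonicity survives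
  there; strictness holds at the start of an ascent.\<close>

lemma chain_half_valley_coords_aux:
  assumes "d + u + length p = m" "\<forall>v\<in>set (half_valley_coords d u p). fst v \<le> snd v"
  shows "(\<forall>d' u' vs. half_valley_coords d u p = (d', u') # vs \<longrightarrow> chain m d' u' vs) \<and>
         (p = [] \<or> hd p = U \<longrightarrow> chain m d u (half_valley_coords d u p))"
  using assms
proof (induction d u p rule: half_valley_coords.induct)
  case (2 d u p)
  then have *: "\<forall>d' u' vs. half_valley_coords d (u + 1) p = (d', u') # vs \<longrightarrow> chain m d' u' vs"
    by simp
  have "chain m d u (half_valley_coords d (u + 1) p)"
  proof (cases "half_valley_coords d (u + 1) p")
    case Nil
    then show ?thesis using 2 by simp
  next
    case (Cons v vs)
    obtain d' u' where v: "v = (d', u')" by (cases v)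
    have "d < d'" "u + 1 \<le> u'"
      using half_valley_coords_ge[of v d "u + 1" p] unfolding Cons v by auto
    moreover have "d' \<le> u'" using "2.prems"(2) unfolding half_valley_coords.simps(2) Cons v by simp
    ultimately show ?thesis using * unfolding Cons v by simp
  qed
  with * show ?case by simp
qed auto

lemma chain_half_valley_coords:
  assumes "length p = m" "\<forall>v\<in>set (half_valley_coords 0 0 p). fst v \<le> snd v"
  shows "chain m 0 0 (half_valley_coords 0 0 p)"
proof (cases "p = [] \<or> hd p = U")
  case True
  then show ?thesis using chain_half_valley_coords_aux[of 0 0 p m] assms by auto
next
  \<comment> \<open>An initial descent would put a valley at \<open>(Suc k, 0)\<close>, below the
    axis.\<close>
  case False
  then obtain q where "p = D # q" by (cases p; cases "hd p") auto
  moreover obtain k vs where "half_valley_coords 0 0 (D # q) = (0 + Suc k, 0) # vs"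
    using half_valley_coords_D by blast
  ultimately have "(Suc k, 0) \<in> set (half_valley_coords 0 0 p)" by simp
  with assms(2) show ?thesis by fastforce
qed

lemma chain_le: "chain m d u ps \<Longrightarrow> v \<in> set ps \<Longrightarrow> fst v \<le> snd v"
  by (induction m d u ps rule: chain.induct) auto

section \<open>Valley positions and the ballot condition\<close>

lemma set_half_valley_coords:
  "set (half_valley_coords d u p) =
    {(d + count_list (take i p) D, u + count_list (take i p) U) | i.
      1 \<le> i \<and> i \<le> length p \<and> p ! (i - 1) = D \<and> (i < length p \<longrightarrow> p ! i = U)}"
  (is "_ = ?R d u p")
proof -
  \<comment> \<open>The positional description obeys a one-letter recursion: position 1 is a valley
    iff \<open>s\<close> is a down step that ends its descent, and the other positions shift by
    one.\<close>
  have step: "?R d u (s # q) =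
      (if s = D \<and> (q = [] \<or> hd q = U) then {(d + 1, u)} else {}) \<union>
      ?R (if s = D then d + 1 else d) (if s = U then u + 1 else u) q" (is "_ = ?A \<union> ?B") for d u s q
  proof (intro equalityI subsetI)
    fix x assume "x \<in> ?R d u (s # q)"
    then obtain i where i: "1 \<le> i" "i \<le> length (s # q)" "(s # q) ! (i - 1) = D"
        "i < length (s # q) \<longrightarrow> (s # q) ! i = U"
      and x: "x = (d + count_list (take i (s # q)) D, u + count_list (take i (s # q)) U)"
      by blast
    then obtain k where k: "i = Suc k" by (cases i) auto
    show "x \<in> ?A \<union> ?B"
    proof (cases k)
      case 0
      then show ?thesis using i x k by (cases q) auto
    next
      case (Suc l)
      then have "x \<in> ?B" using i x k by (intro CollectI exI[of _ k]) (auto split: if_splits)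
      then show ?thesis by blast
    qed
  next
    fix x assume "x \<in> ?A \<union> ?B"
    then show "x \<in> ?R d u (s # q)"
    proof
      assume "x \<in> ?A"
      then show ?thesis
        by (intro CollectI exI[of _ 1]) (cases q; auto split: if_splits)
    next
      assume "x \<in> ?B"
      then obtain i where i: "1 \<le> i" "i \<le> length q" "q ! (i - 1) = D" "i < length q \<longrightarrow> q ! i = U"
        and x: "x = ((if s = D then d + 1 else d) + count_list (take i q) D,
                     (if s = U then u + 1 else u) + count_list (take i q) U)"
        by blast
      then show ?thesis
        by (intro CollectI exI[of _ "Suc i"]) (cases s; auto simp: nth_Cons')
    qed
  qed
  show ?thesis
  proof (induction d u p rule: half_valley_coords.induct)
    case (1 d u)
    then show ?case by auto
  next
    case (2 d u p)
    show ?case unfolding step half_valley_coords.simps 2 by simp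
  next
    case (3 d u)
    show ?case unfolding step by auto
  next
    case (4 d u p)
    show ?case unfolding step[where s = D] half_valley_coords.simps(4) list.set(2) 4 by simp
  next
    case (5 d u p)
    show ?case unfolding step[where s = D] half_valley_coords.simps(5) 5 by simp
  qed
qed

text \<open>The height is lowest at the start or at the end of a descent, and every such end,
  including a final one, is listed as a valley.\<close>

lemma ballot_iff_valleys:
  "(\<forall>k\<le>length p. d + count_list (take k p) D \<le> u + count_list (take k p) U) \<longleftrightarrow>
    d \<le> u \<and> (\<forall>v\<in>set (half_valley_coords d u p). fst v \<le> snd v)" (is "?B d u p \<longleftrightarrow> _")
proof -
  have all_le_Suc: "(\<forall>k\<le>Suc n. P k) \<longleftrightarrow> P 0 \<and> (\<forall>k\<le>n. P (Suc k))" for n and P :: "nat \<Rightarrow> bool"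
    by (metis Suc_le_mono le0 not0_implies_Suc)
  have step: "?B d u (s # q) \<longleftrightarrow> d \<le> u \<and>
      ?B (if s = D then d + 1 else d) (if s = U then u + 1 else u) q" for d u s q
    unfolding list.size(4) add_Suc_right add_0_right Suc_eq_plus1[symmetric] all_le_Suc
    by (cases s) simp_all
  have step_U: "?B d u (U # q) \<longleftrightarrow> d \<le> u \<and> ?B d (u + 1) q"
    and step_D: "?B d u (D # q) \<longleftrightarrow> d \<le> u \<and> ?B (d + 1) u q" for d u q
    unfolding step by (simp_all only: step.distinct if_True if_False refl)
  show ?thesis
  proof (induction d u p rule: half_valley_coords.induct)
    case (1 d u)
    then show ?case by auto
  next
    case (2 d u p)
    show ?case
      unfolding step_U 2 half_valley_coords.simps
      using half_valley_coords_ge[of _ d "u + 1" p] by auto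
  next
    case (3 d u)
    show ?case unfolding step_D by auto
  next
    case (4 d u p)
    show ?case unfolding step_D[where d = d] 4 half_valley_coords.simps(4) by auto
  next
    case (5 d u p)
    \<comment> \<open>This valley ends the current descent, so its condition implies the one at the
      intermediate point \<open>(d + 1, u)\<close>.\<close>
    obtain k vs where "half_valley_coords (d + 1) u (D # p) = (d + 1 + Suc k, u) # vs"
      using half_valley_coords_D by blast
    then show ?case unfolding step_D[where d = d] 5 half_valley_coords.simps(5) by auto
  qed
qed

section \<open>Symmetric paths\<close>

definition symmetrize :: "step list \<Rightarrow> step list" where
  "symmetrize p = p @ rev (map flip p)"

text \<open>Inverse of the change of coordinates given by \<open>down_coord\<close> and
  \<open>up_coord\<close>.\<close>

definition valley_point :: "nat \<times> nat \<Rightarrow> int \<times> int" where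
  "valley_point v = (int (snd v) + int (fst v), int (snd v) - int (fst v))"

lemma flip_flip [simp]: "flip (flip s) = s"
  by (cases s) auto

lemma flip_eq_iff [simp]: "flip s = U \<longleftrightarrow> s = D" "flip s = D \<longleftrightarrow> s = U"
  by (cases s; simp)+

lemma count_list_map_flip [simp]:
  "count_list (map flip p) U = count_list p D" "count_list (map flip p) D = count_list p U"
  by (induction p) auto

lemma nth_symmetrize:
  assumes "k < 2 * length p"
  shows "symmetrize p ! k = (if k < length p then p ! k else flip (p ! (2 * length p - 1 - k)))"
  using assms by (auto simp: symmetrize_def nth_append rev_nth mult_2)

lemma length_symmetrize [simp]: "length (symmetrize p) = 2 * length p"
  by (simp add: symmetrize_def)

lemma take_symmetrize [simp]: "k \<le> length p \<Longrightarrow> take k (symmetrize p) = take k p"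
  by (simp add: symmetrize_def)

lemma symmetrize_in_SDyck:
  assumes "\<forall>k\<le>length p. count_list (take k p) D \<le> count_list (take k p) U"
  shows "symmetrize p \<in> SDyck (length p)"
proof -
  have "count_list (take k (symmetrize p)) D \<le> count_list (take k (symmetrize p)) U"
    if k: "k \<le> 2 * length p" for k
  proof (cases "k \<le> length p")
    case True
    then show ?thesis using assms by simp
  next
    case False
    \<comment> \<open>\<open>j\<close> is the mirror image of \<open>k\<close>: the flipped,
      reversed copy of \<open>drop j p\<close> cancels the height gained on \<open>drop j p\<close>,
      so the heights at \<open>k\<close> and \<open>j\<close> agree.\<close>
    define j where "j = 2 * length p - k"
    have j: "j \<le> length p" "k - length p = length p - j" using False k by (auto simp: j_def)
    have "take k (symmetrize p) = p @ rev (map flip (drop j p))"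
      using False j by (simp add: symmetrize_def take_rev drop_map)
    moreover have "count_list p s = count_list (take j p) s + count_list (drop j p) s" for s
      by (metis append_take_drop_id count_list_append)
    ultimately show ?thesis using assms j by simp
  qed
  moreover have "letter (symmetrize p) (2 * length p + 1 - i) = flip (letter (symmetrize p) i)"
    if "i \<in> {1..2 * length p}" for i
    using that by (auto simp: letter_def nth_symmetrize intro!: arg_cong[where f = "(!) p"])
  moreover have "count_list (symmetrize p) U = count_list (symmetrize p) D"
    by (simp add: symmetrize_def)
  ultimately show ?thesis by (simp add: SDyck_def dyck_path_def)
qed

lemma SDyck_symmetrizeE:
  assumes "w \<in> SDyck m"
  obtains p where "length p = m" "w = symmetrize p"
    "\<forall>k\<le>length p. count_list (take k p) D \<le> count_list (take k p) U"
proof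
  have len: "length w = 2 * m"
    and pre: "\<And>k. k \<le> 2 * m \<Longrightarrow> count_list (take k w) D \<le> count_list (take k w) U"
    and sym: "\<And>i. 1 \<le> i \<Longrightarrow> i \<le> 2 * m \<Longrightarrow> letter w (2 * m + 1 - i) = flip (letter w i)"
    using assms by (auto simp: SDyck_def dyck_path_def)
  show len_take: "length (take m w) = m" using len by simp
  show "w = symmetrize (take m w)"
  proof (rule nth_equalityI)
    fix k assume k: "k < length w"
    then show "w ! k = symmetrize (take m w) ! k"
      \<comment> \<open>The 0-based index \<open>k\<close> is letter
        \<open>k + 1 = 2 * m + 1 - (2 * m - k)\<close>.\<close>
      using sym[of "2 * m - k"] by (auto simp: nth_symmetrize len letter_def)
  qed (simp add: len)
  show "\<forall>k\<le>length (take m w). count_list (take k (take m w)) D \<le> count_list (take k (take m w)) U"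
    using pre by (auto simp: len min_def)
qed

lemma half_valleys_symmetrize:
  assumes "length p = 2 * n"
  shows "half_valleys n (symmetrize p) = valley_point ` set (half_valley_coords 0 0 p)"
proof -
  have "half_valleys n (symmetrize p) =
    {(int i, height (symmetrize p) i) | i. 1 \<le> i \<and> i \<le> length p \<and>
       symmetrize p ! (i - 1) = D \<and> symmetrize p ! i = U}"
    using assms by (auto simp: half_valleys_def valleys_def letter_def)
  also have "\<dots> = {(int i, height p i) | i. 1 \<le> i \<and> i \<le> length p \<and>
       p ! (i - 1) = D \<and> (i < length p \<longrightarrow> p ! i = U)}"
  proof -
    \<comment> \<open>At the midpoint the next letter is the flip of the last letter of
      \<open>p\<close>, hence an up step exactly when \<open>p\<close> ends with a down
      step.\<close>
    have "symmetrize p ! (i - 1) = p ! (i - 1)"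
      and "symmetrize p ! i = U \<longleftrightarrow> (if i = length p then p ! (i - 1) = D else p ! i = U)"
      and "height (symmetrize p) i = height p i" if "1 \<le> i" "i \<le> length p" for i
      using that by (auto simp: nth_symmetrize mult_2 height_def)
    then show ?thesis by (intro Collect_cong ex_cong1) (auto split: if_splits)
  qed
  also have "\<dots> = valley_point ` set (half_valley_coords 0 0 p)"
  proof -
    have "(int i, height p i) = valley_point (count_list (take i p) D, count_list (take i p) U)"
      if "i \<le> length p" for i
    proof -
      have "count_list q U + count_list q D = length q" for q
      proof (induction q)
        case (Cons s q)
        then show ?case by (cases s) auto
      qed simp
      from this[of "take i p"] that
      have "int i = int (count_list (take i p) U) + int (count_list (take i p) D)" by simp
      then show ?thesis by (simp add: valley_point_def height_def)
    qed
    then show ?thesis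
      unfolding set_half_valley_coords image_Collect[symmetric] image_image by (intro image_cong) auto
  qed
  finally show ?thesis .
qed

lemma inj_valley_point: "inj valley_point"
  by (rule injI) (auto simp: valley_point_def prod_eq_iff)

text \<open>Interpreting \<open>folding_insort_key\<close> at a proper subset of the key domain yields the locale
  constant rather than the class constant.\<close>

lemma locale_sorted_key_list_of_set_eq:
  "linorder.sorted_key_list_of_set (\<le>) f = sorted_key_list_of_set (f :: 'a \<Rightarrow> 'b::linorder)"
  by (simp add: sorted_key_list_of_set_def insort_key_def
      linorder.sorted_key_list_of_set_def[OF linorder_class.linorder_axioms]
      linorder.insort_key_def[OF linorder_class.linorder_axioms])

text \<open>Both coordinates increase along a chain, hence so does the abscissa, their sum; a
  strictly sorted enumeration of a set is unique.\<close>

lemma sorted_list_valley_points: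
  assumes "chain m 0 0 ps"
  shows "sorted_key_list_of_set fst (valley_point ` set ps) = map valley_point ps"
proof -
  let ?qs = "map valley_point ps"
  have sorted: "sorted_wrt (<) (map fst ?qs)"
    using chain_sorted[OF assms]
    by (auto simp: sorted_wrt_map valley_point_def elim: sorted_wrt_mono_rel[rotated])
  then have dist: "distinct (map fst ?qs)" by (simp add: strict_sorted_iff)
  then interpret folding_insort_key "(\<le>)" "(<)" "set ?qs" fst
    by unfold_locales (simp only: distinct_map)
  have "length ?qs = card (set ?qs)"
    using dist by (metis distinct_card distinct_map)
  with sorted show ?thesis
    using sorted_key_list_of_set_unique[of "set ?qs" ?qs]
    by (simp add: locale_sorted_key_list_of_set_eq)
qed

lemma distinct_chain: "chain m d u ps \<Longrightarrow> distinct ps"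
  by (induction m d u ps rule: chain.induct) (auto dest: chain_gt)

lemma card_valley_points:
  assumes "chain m d u ps"
  shows "card (valley_point ` set ps) = length ps"
  using distinct_card[OF distinct_chain[OF assms]]
    card_image[OF inj_on_subset[OF inj_valley_point subset_UNIV], of "set ps"] by simp

lemma SDyck_chainE:
  assumes "w \<in> SDyck (2 * n)"
  obtains p where "length p = 2 * n" "w = symmetrize p" "chain (2 * n) 0 0 (half_valley_coords 0 0 p)"
    "half_valleys n w = valley_point ` set (half_valley_coords 0 0 p)"
    "half_valley_list n w = map valley_point (half_valley_coords 0 0 p)"
proof -
  obtain p where p: "length p = 2 * n" "w = symmetrize p"
    and ballot: "\<forall>k\<le>length p. count_list (take k p) D \<le> count_list (take k p) U"
    using SDyck_symmetrizeE[OF assms] by blast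
  have "chain (2 * n) 0 0 (half_valley_coords 0 0 p)"
    using ballot ballot_iff_valleys[of p 0 0] chain_half_valley_coords[OF p(1)] by simp
  then show ?thesis
    using p half_valleys_symmetrize[OF p(1)] sorted_list_valley_points[of "2 * n"]
    by (intro that[of p]) (simp_all add: half_valley_list_def)
qed

text \<open>A valley set fixes its sorted list, the list fixes the chain, and the chain fixes the
  half path of length \<open>2 * n\<close>.\<close>

lemma inj_on_half_valleys: "inj_on (half_valleys n) (SDyck (2 * n))"
proof (rule inj_onI)
  fix w w' assume w: "w \<in> SDyck (2 * n)" "w' \<in> SDyck (2 * n)"
    and eq: "half_valleys n w = half_valleys n w'"
  obtain p where p: "length p = 2 * n" "w = symmetrize p"
      "half_valley_list n w = map valley_point (half_valley_coords 0 0 p)"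
    using w(1) by (rule SDyck_chainE) (rule that)
  obtain q where q: "length q = 2 * n" "w' = symmetrize q"
      "half_valley_list n w' = map valley_point (half_valley_coords 0 0 q)"
    using w(2) by (rule SDyck_chainE) (rule that)
  have "map valley_point (half_valley_coords 0 0 p) = map valley_point (half_valley_coords 0 0 q)"
    using p(3) q(3) eq by (simp add: half_valley_list_def)
  then have "half_valley_coords 0 0 p = half_valley_coords 0 0 q"
    by (simp only: inj_map_eq_map[OF inj_valley_point])
  then have "p = q" using half_valley_coords_inj p(1) q(1) by metis
  then show "w = w'" by (simp only: p(2) q(2))
qed

section \<open>Faces and their degrees\<close>

lemma SDyck_complex_eq:
  "SDyck_complex n = {valley_point ` set ps | ps. chain (2 * n) 0 0 ps}"
proof (intro equalityI subsetI)
  fix \<sigma> assume "\<sigma> \<in> SDyck_complex n"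
  then obtain w where "w \<in> SDyck (2 * n)" "\<sigma> = half_valleys n w"
    by (auto simp: SDyck_complex_def)
  moreover from this(1) obtain p where "chain (2 * n) 0 0 (half_valley_coords 0 0 p)"
      "half_valleys n w = valley_point ` set (half_valley_coords 0 0 p)"
    by (rule SDyck_chainE) (rule that)
  ultimately show "\<sigma> \<in> {valley_point ` set ps | ps. chain (2 * n) 0 0 ps}" by blast
next
  fix \<sigma> assume "\<sigma> \<in> {valley_point ` set ps | ps. chain (2 * n) 0 0 ps}"
  then obtain ps where ps: "\<sigma> = valley_point ` set ps" "chain (2 * n) 0 0 ps" by blast
  \<comment> \<open>This half has valley list \<open>ps\<close>; it satisfies the ballot condition
    because the points of a chain do.\<close>
  define p where "p = chain_path (2 * n) 0 0 ps"
  have len: "length p = 2 * n" using length_chain_path[OF ps(2)] by (simp add: p_def)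
  have coords: "half_valley_coords 0 0 p = ps"
    using half_valley_coords_chain_path[OF ps(2)] by (simp add: p_def)
  then have "symmetrize p \<in> SDyck (2 * n)"
    using symmetrize_in_SDyck[of p] ballot_iff_valleys[of p 0 0] chain_le[OF ps(2)] len by simp
  moreover have "half_valleys n (symmetrize p) = \<sigma>"
    using half_valleys_symmetrize[OF len] coords ps by simp
  ultimately show "\<sigma> \<in> SDyck_complex n" by (auto simp: SDyck_complex_def)
qed

lemma face_degree_chain:
  assumes "chain (2 * n) 0 0 ps"
  shows "face_degree (SDyck_complex n) (valley_point ` set ps) = chain_degree (2 * n) 0 0 ps"
proof -
  let ?C = "{card \<tau> | \<tau>. \<tau> \<in> SDyck_complex n \<and> valley_point ` set ps \<subseteq> \<tau>}"
  have "\<forall>c\<in>?C. c \<le> chain_degree (2 * n) 0 0 ps"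
  proof
    fix c assume "c \<in> ?C"
    then obtain qs where "chain (2 * n) 0 0 qs" "valley_point ` set ps \<subseteq> valley_point ` set qs"
        "c = card (valley_point ` set qs)"
      by (auto simp: SDyck_complex_eq)
    then show "c \<le> chain_degree (2 * n) 0 0 ps"
      using length_le_chain_degree[OF assms] card_valley_points inj_image_subset_iff[OF inj_valley_point]
      by simp
  qed
  moreover have "chain_degree (2 * n) 0 0 ps \<in> ?C"
    using chain_saturate[OF assms] card_valley_points length_saturate[OF assms]
      set_subset_saturate[of ps "2 * n" 0 0]
    by (intro CollectI exI[of _ "valley_point ` set (saturate (2 * n) 0 0 ps)"])
      (auto simp: SDyck_complex_eq)
  \<comment> \<open>Finiteness, required for \<open>Max\<close>, comes from the upper bound just
    shown.\<close>
  moreover have "finite ?C"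
    using calculation(1) by (intro finite_subset[of ?C "{..chain_degree (2 * n) 0 0 ps}"]) blast+
  ultimately show ?thesis unfolding face_degree_def by (intro Max_eqI) auto
qed

lemma coords_valley_point [simp]:
  "down_coord (valley_point v) = int (fst v)" "up_coord (valley_point v) = int (snd v)"
  by (simp_all add: down_coord_def up_coord_def valley_point_def)

lemma mu_B_eq_face_degree:
  assumes "w \<in> SDyck (2 * n)"
  shows "mu_B n w = int (face_degree (SDyck_complex n) (half_valleys n w))"
proof -
  obtain p where p: "chain (2 * n) 0 0 (half_valley_coords 0 0 p)"
      "half_valleys n w = valley_point ` set (half_valley_coords 0 0 p)"
      "half_valley_list n w = map valley_point (half_valley_coords 0 0 p)"
    using assms by (rule SDyck_chainE) (rule that)
  define ps where "ps = half_valley_coords 0 0 p"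
  note p = p[folded ps_def]
  have "mu_B n w = int (chain_degree (2 * n) 0 0 ps)"
  proof (cases "ps = []")
    case True
    then show ?thesis using p by (simp add: mu_B_def)
  next
    case False
    \<comment> \<open>This turns the first gap, measured from the origin, into the leading term
      \<open>d 0\<close> of \<open>mu_B\<close>.\<close>
    have "fst (ps ! 0) \<le> snd (ps ! 0)" using chain_le[OF p(1)] False by simp
    then show ?thesis
      using False p unfolding chain_degree_sum[OF p(1) False]
      by (simp add: mu_B_def Let_def)
  qed
  then show ?thesis using face_degree_chain[OF p(1)] p(2) by simp
qed

theorem theorem4p4:
  fixes n i j :: nat
  assumes "n \<ge> 1" and "j \<le> i" and "i \<le> n"
  shows "f_triangle (SDyck_complex n) i j =
    card {w \<in> SDyck (2 * n). card (half_valleys n w) = j \<and> mu_B n w = int i}"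
proof -
  let ?A = "{w \<in> SDyck (2 * n). card (half_valleys n w) = j \<and> mu_B n w = int i}"
  \<comment> \<open>Each face is the valley set of a path whose \<open>mu_B\<close> is the degree of
    that face; injectivity then turns the image into an equality of counts.\<close>
  have "{\<sigma> \<in> SDyck_complex n. card \<sigma> = j \<and> face_degree (SDyck_complex n) \<sigma> = i} = half_valleys n ` ?A"
    by (auto simp: mu_B_eq_face_degree) (auto simp: SDyck_complex_def mu_B_eq_face_degree)
  moreover have "inj_on (half_valleys n) ?A"
    by (rule inj_on_subset[OF inj_on_half_valleys]) auto
  ultimately show ?thesis by (simp add: f_triangle_def card_image)
qed

end
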